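(* Let $X=(X_k)$ be a sequence of fuzzy numbers, let $X_0$ be a fuzzy number, and let $0<\beta\le\gamma\le1$. Let $f$ be an unbounded modulus function such that there is a positive constant $c$ with $f(xy)\ge c\,f(x)f(y)$ for all $x\ge0$, $y\ge0$, and such that $\lim_{t\to\infty}\frac{f(t)}{t}>0$. If $X$ is strongly Cesàro summable of order $\beta$ with respect to the modulus function $f$ to $X_0$, then $X$ is $f$-statistically convergent of order $\gamma$ to $X_0$.
   Context: A fuzzy number is a function $u:\mathbb{R}\to[0,1]$ such that (i) $u(x_0)=1$ for some $x_0\in\mathbb{R}$; (ii) $u(\lambda x+(1-\lambda)y)\ge\min[u(x),u(y)]$ for all $x,y\in\mathbb{R}$, $0\le\lambda\le1$; (iii) $u$ is upper semicontinuous; (iv) $\operatorname{supp}u=\mathrm{cl}\{x\in\mathbb{R}:u(x)>0\}$ is compact. The $\alpha$-level set is $[u]^{\alpha}=\{x:u(x)\ge\alpha\}$ for $\alpha\in(0,1]$ and $[u]^0=\operatorname{supp}u$; each is a closed interval $[\underline{u}^{\alpha},\overline{u}^{\alpha}]$. The set $L(\mathbb{R})$ of fuzzy numbers carries the metric $d(u,v)=\sup_{0\le\alpha\le1}\max\{|\underline{u}^{\alpha}-\underline{v}^{\alpha}|,|\overline{u}^{\alpha}-\overline{v}^{\alpha}|\}$. A sequence of fuzzy numbers is a function $X:\mathbb{N}\to L(\mathbb{R})$, written $X=(X_k)_{k\ge1}$. A modulus function is a map $f:[0,\infty)\to[0,\infty)$ such that $f(x)=0$ iff $x=0$; $f(x+y)\le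 f(x)+f(y)$ for $x,y\ge0$; $f$ is increasing (i.e. $x\le y$ implies $f(x)\le f(y)$); and $f$ is right-continuous at $0$. $X$ is strongly Cesàro summable of order $\beta$ with respect to $f$ to $X_0$ if $\lim_{n\to\infty}\frac{1}{n^{\beta}}\sum_{k=1}^{n}f(d(X_k,X_0))=0$. $X$ is $f$-statistically convergent of order $\gamma$ to $X_0$ if for each $\varepsilon>0$, $\lim_{n\to\infty}\frac{1}{f(n^{\gamma})}f\left(|\{k\le n:d(X_k,X_0)\ge\varepsilon\}|\right)=0$, where $|\cdot|$ denotes cardinality. *)

theory Defs
  imports "HOL-Analysis.Analysis"
begin

definition upper_semicontinuous :: "(real \<Rightarrow> real) \<Rightarrow> bool" where
  "upper_semicontinuous u \<longleftrightarrow> (\<forall>x y. u x < y \<longrightarrow> (\<forall>\<^sub>F z in nhds x. u z < y))"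

definition supp :: "(real \<Rightarrow> real) \<Rightarrow> real set" where
  "supp u = closure {x. u x > 0}"

text \<open>The set \<open>L(\<real>)\<close>; fuzzy numbers are real-valued functions with range in \<open>[0,1]\<close>.\<close>

definition fuzzy_numbers :: "(real \<Rightarrow> real) set" where
  "fuzzy_numbers = {u. range u \<subseteq> {0..1}
     \<and> (\<exists>x\<^sub>0. u x\<^sub>0 = 1)
     \<and> (\<forall>x y l. 0 \<le> l \<and> l \<le> 1 \<longrightarrow> u (l * x + (1 - l) * y) \<ge> min (u x) (u y))
     \<and> upper_semicontinuous u
     \<and> compact (supp u)}"

definition level_set :: "(real \<Rightarrow> real) \<Rightarrow> real \<Rightarrow> real set" where
  "level_set u \<alpha> = (if \<alpha> = 0 then supp u else {x. u x \<ge> \<alpha>})"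

text \<open>For a fuzzy number and \<open>0 \<le> \<alpha> \<le> 1\<close> the level set is a nonempty compact interval,
  so its endpoints are its infimum and supremum.\<close>

definition lower_end :: "(real \<Rightarrow> real) \<Rightarrow> real \<Rightarrow> real" where
  "lower_end u \<alpha> = Inf (level_set u \<alpha>)"

definition upper_end :: "(real \<Rightarrow> real) \<Rightarrow> real \<Rightarrow> real" where
  "upper_end u \<alpha> = Sup (level_set u \<alpha>)"

text \<open>On fuzzy numbers the supremum is over a bounded set, since all level sets of \<open>u\<close> and \<open>v\<close>
  lie in the compact sets \<open>supp u\<close> and \<open>supp v\<close>.\<close>

definition fuzzy_dist :: "(real \<Rightarrow> real) \<Rightarrow> (real \<Rightarrow> real) \<Rightarrow> real" where
  "fuzzy_dist u v = (SUP \<alpha>\<in>{0..1}.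
     max \<bar>lower_end u \<alpha> - lower_end v \<alpha>\<bar> \<bar>upper_end u \<alpha> - upper_end v \<alpha>\<bar>)"

text \<open>A map \<open>[0,\<infinity>) \<rightarrow> [0,\<infinity>)\<close> is a function on \<open>real\<close> whose values at negative arguments
  are irrelevant.\<close>

definition modulus_function :: "(real \<Rightarrow> real) \<Rightarrow> bool" where
  "modulus_function f \<longleftrightarrow>
     (\<forall>x\<ge>0. f x \<ge> 0)
     \<and> (\<forall>x\<ge>0. f x = 0 \<longleftrightarrow> x = 0)
     \<and> (\<forall>x\<ge>0. \<forall>y\<ge>0. f (x + y) \<le> f x + f y)
     \<and> mono_on {0..} f
     \<and> continuous (at_right 0) f"

text \<open>Sequences are indexed from \<open>1\<close>; the value at index \<open>0\<close> is never used.\<close>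

definition strongly_Cesaro_summable ::
    "real \<Rightarrow> (real \<Rightarrow> real) \<Rightarrow> (nat \<Rightarrow> real \<Rightarrow> real) \<Rightarrow> (real \<Rightarrow> real) \<Rightarrow> bool" where
  "strongly_Cesaro_summable \<beta> f X X\<^sub>0 \<longleftrightarrow>
     (\<lambda>n. 1 / real n powr \<beta> * (\<Sum>k=1..n. f (fuzzy_dist (X k) X\<^sub>0))) \<longlonglongrightarrow> 0"

definition f_statistically_convergent ::
    "real \<Rightarrow> (real \<Rightarrow> real) \<Rightarrow> (nat \<Rightarrow> real \<Rightarrow> real) \<Rightarrow> (real \<Rightarrow> real) \<Rightarrow> bool" where
  "f_statistically_convergent \<gamma> f X X\<^sub>0 \<longleftrightarrow>
     (\<forall>\<epsilon>>0. (\<lambda>n. 1 / f (real n powr \<gamma>)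
        * f (real (card {k \<in> {1..n}. fuzzy_dist (X k) X\<^sub>0 \<ge> \<epsilon>}))) \<longlonglongrightarrow> 0)"

end

theory Submission
  imports Defs
begin

text \<open>Fix \<open>\<epsilon> > 0\<close> and let \<open>K\<^sub>n\<close> be the number of indices \<open>k \<le> n\<close> at distance at least \<open>\<epsilon>\<close>
  from the limit. Markov's inequality for the counting measure gives
  \<open>K\<^sub>n f(\<epsilon>) \<le> (\<Sum>k=1..n. f(d(X\<^sub>k, X\<^sub>0)))\<close>, and subadditivity makes a modulus grow at most
  linearly on the naturals, \<open>f(K\<^sub>n) \<le> K\<^sub>n f(1)\<close>. Together they bound the numerator
  \<open>f(K\<^sub>n)\<close> by a constant multiple of the Cesaro sum
  (\<open>modulus_count_le_sum\<close>). The positive limit \<open>l\<close> of \<open>f(t)/t\<close> says that \<open>f\<close> also grows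
  at least linearly, so that the denominator satisfies
  \<open>f(n\<^sup>\<gamma>) \<ge> (l/2) n\<^sup>\<gamma> \<ge> (l/2) n\<^sup>\<beta>\<close> for large \<open>n\<close>
  (\<open>eventually_modulus_powr_ge\<close>). Hence the quotient is at most a constant times the Cesaro mean
  of order \<open>\<beta>\<close>, which tends to zero.

  A modulus is constrained on \<open>[0,\<infinity>)\<close> only, so the argument rests on \<open>d \<ge> 0\<close>. As \<open>d\<close> is
  a supremum of reals, this requires the family of endpoint differences to be bounded, which
  follows from compactness of the supports.\<close>

section \<open>The distance of fuzzy numbers is nonnegative\<close>

lemma level_set_subset_supp:
  assumes "0 \<le> \<alpha>"
  shows "level_set u \<alpha> \<subseteq> supp u"
  using assms closure_subset[of "{x. u x > 0}"]
  by (auto simp: level_set_def supp_def)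

lemma fuzzy_level_set_nonempty:
  assumes "u \<in> fuzzy_numbers" and "0 \<le> \<alpha>" and "\<alpha> \<le> 1"
  shows "level_set u \<alpha> \<noteq> {}"
proof -
  obtain x where x: "u x = 1"
    using assms(1) by (auto simp: fuzzy_numbers_def)
  then have "x \<in> supp u"
    using closure_subset[of "{x. u x > 0}"] by (auto simp: supp_def)
  with x assms show ?thesis
    by (auto simp: level_set_def intro!: exI[of _ x])
qed

lemma fuzzy_ends_bounded:
  assumes "u \<in> fuzzy_numbers"
  obtains B where "\<And>\<alpha>. 0 \<le> \<alpha> \<Longrightarrow> \<alpha> \<le> 1 \<Longrightarrow> \<bar>lower_end u \<alpha>\<bar> \<le> B \<and> \<bar>upper_end u \<alpha>\<bar> \<le> B"
proof -
  have "bounded (supp u)"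
    using assms by (auto simp: fuzzy_numbers_def intro: compact_imp_bounded)
  then obtain B where B: "\<And>x. x \<in> supp u \<Longrightarrow> \<bar>x\<bar> \<le> B"
    by (auto simp: bounded_iff)
  show ?thesis
  proof (rule that[of B])
    fix \<alpha> :: real assume \<alpha>: "0 \<le> \<alpha>" "\<alpha> \<le> 1"
    note ne = fuzzy_level_set_nonempty[OF assms \<alpha>]
    have "\<And>x. x \<in> level_set u \<alpha> \<Longrightarrow> \<bar>x\<bar> \<le> B"
      using B level_set_subset_supp[OF \<alpha>(1)] by blast
    then show "\<bar>lower_end u \<alpha>\<bar> \<le> B \<and> \<bar>upper_end u \<alpha>\<bar> \<le> B"
      unfolding lower_end_def upper_end_def
      using cInf_abs_ge[OF ne] cSup_abs_le[OF ne] by blast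
  qed
qed

lemma fuzzy_dist_nonneg:
  assumes "u \<in> fuzzy_numbers" and "v \<in> fuzzy_numbers"
  shows "0 \<le> fuzzy_dist u v"
proof -
  obtain B where B: "\<And>\<alpha>. 0 \<le> \<alpha> \<Longrightarrow> \<alpha> \<le> 1 \<Longrightarrow> \<bar>lower_end u \<alpha>\<bar> \<le> B \<and> \<bar>upper_end u \<alpha>\<bar> \<le> B"
    using fuzzy_ends_bounded[OF assms(1)] by blast
  obtain C where C: "\<And>\<alpha>. 0 \<le> \<alpha> \<Longrightarrow> \<alpha> \<le> 1 \<Longrightarrow> \<bar>lower_end v \<alpha>\<bar> \<le> C \<and> \<bar>upper_end v \<alpha>\<bar> \<le> C"
    using fuzzy_ends_bounded[OF assms(2)] by blast
  let ?g = "\<lambda>\<alpha>. max \<bar>lower_end u \<alpha> - lower_end v \<alpha>\<bar> \<bar>upper_end u \<alpha> - upper_end v \<alpha>\<bar>"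
  have "bdd_above (?g ` {0..1})"
  proof (rule bdd_aboveI2)
    fix \<alpha> :: real assume "\<alpha> \<in> {0..1}"
    then show "?g \<alpha> \<le> B + C" using B[of \<alpha>] C[of \<alpha>] by auto
  qed
  then have "?g 0 \<le> fuzzy_dist u v"
    unfolding fuzzy_dist_def by (intro cSUP_upper) auto
  then show ?thesis by linarith
qed

section \<open>Linear bounds for modulus functions\<close>

lemma modulus_of_nat_le:
  assumes "modulus_function f"
  shows "f (real m) \<le> real m * f 1"
proof (induction m)
  case 0
  have "f 0 = 0" using assms by (auto simp: modulus_function_def)
  then show ?case by simp
next
  case (Suc m)
  have "f (real m + 1) \<le> f (real m) + f 1"
    using assms by (simp add: modulus_function_def)
  with Suc show ?case by (simp add: algebra_simps)
qed

text \<open>Markov's inequality for the counting measure on \<open>A\<close>, combined with the linear bound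
  above.\<close>

lemma modulus_count_le_sum:
  fixes d :: "'a \<Rightarrow> real"
  assumes f: "modulus_function f" and A: "finite A"
    and d: "\<And>k. k \<in> A \<Longrightarrow> 0 \<le> d k" and \<epsilon>: "0 < \<epsilon>"
  shows "f (real (card {k \<in> A. d k \<ge> \<epsilon>})) \<le> f 1 / f \<epsilon> * (\<Sum>k\<in>A. f (d k))"
proof -
  let ?S = "{k \<in> A. d k \<ge> \<epsilon>}"
  have nonneg: "0 \<le> f x" if "0 \<le> x" for x
    using f that by (simp add: modulus_function_def)
  have mono: "f x \<le> f y" if "0 \<le> x" "x \<le> y" for x y
    using f that by (auto simp: modulus_function_def mono_on_def)
  have "f \<epsilon> \<noteq> 0"
    using f \<epsilon> by (simp add: modulus_function_def)
  then have f\<epsilon>: "0 < f \<epsilon>"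
    using nonneg[of \<epsilon>] \<epsilon> by simp
  have "real (card ?S) * f \<epsilon> = (\<Sum>k\<in>?S. f \<epsilon>)" by simp
  also have "\<dots> \<le> (\<Sum>k\<in>?S. f (d k))"
    using \<epsilon> by (intro sum_mono mono) auto
  also have "\<dots> \<le> (\<Sum>k\<in>A. f (d k))"
    using A d nonneg by (intro sum_mono2) auto
  finally have markov: "real (card ?S) \<le> (\<Sum>k\<in>A. f (d k)) / f \<epsilon>"
    using f\<epsilon> by (simp add: pos_le_divide_eq)
  have "f (real (card ?S)) \<le> real (card ?S) * f 1"
    by (rule modulus_of_nat_le[OF f])
  also have "\<dots> \<le> (\<Sum>k\<in>A. f (d k)) / f \<epsilon> * f 1"
    using markov nonneg[of 1] by (intro mult_right_mono) auto
  finally show ?thesis by (simp add: mult.commute)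
qed

lemma eventually_modulus_powr_ge:
  fixes f :: "real \<Rightarrow> real"
  assumes lim: "((\<lambda>t. f t / t) \<longlongrightarrow> l) at_top" and "0 < l" and "0 < \<beta>" and "\<beta> \<le> \<gamma>"
  shows "\<forall>\<^sub>F n in sequentially. f (real n powr \<gamma>) \<ge> l / 2 * real n powr \<beta>"
proof -
  have "\<forall>\<^sub>F t in at_top. l / 2 < f t / t"
    using order_tendstoD(1)[OF lim, of "l / 2"] \<open>0 < l\<close> by simp
  moreover have "filterlim (\<lambda>n. real n powr \<gamma>) at_top sequentially"
    using assms by (intro filterlim_compose[OF real_powr_at_top filterlim_real_sequentially]) auto
  ultimately have "\<forall>\<^sub>F n in sequentially. l / 2 < f (real n powr \<gamma>) / real n powr \<gamma>"
    by (rule eventually_compose_filterlim)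
  then show ?thesis
    using eventually_gt_at_top[of 0]
  proof eventually_elim
    case (elim n)
    have "l / 2 * real n powr \<beta> \<le> l / 2 * real n powr \<gamma>"
      using elim assms by (intro mult_left_mono powr_mono) auto
    also have "\<dots> \<le> f (real n powr \<gamma>)"
      using elim by (simp add: pos_less_divide_eq)
    finally show ?case .
  qed
qed

section \<open>From strong summability to statistical convergence\<close>

theorem theorem3p16:
  fixes X :: "nat \<Rightarrow> real \<Rightarrow> real" and X\<^sub>0 :: "real \<Rightarrow> real"
    and f :: "real \<Rightarrow> real" and \<beta> \<gamma> :: real
  assumes "\<And>k. k \<ge> 1 \<Longrightarrow> X k \<in> fuzzy_numbers" and "X\<^sub>0 \<in> fuzzy_numbers"
    and "0 < \<beta>" and "\<beta> \<le> \<gamma>" and "\<gamma> \<le> 1"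
    and "modulus_function f" and "\<not> bounded (f ` {0..})"
    and "\<exists>c>0. \<forall>x\<ge>0. \<forall>y\<ge>0. f (x * y) \<ge> c * f x * f y"
    and "\<exists>l>0. ((\<lambda>t. f t / t) \<longlongrightarrow> l) at_top"
    and "strongly_Cesaro_summable \<beta> f X X\<^sub>0"
  shows "f_statistically_convergent \<gamma> f X X\<^sub>0"
  unfolding f_statistically_convergent_def
proof (intro allI impI)
  fix \<epsilon> :: real assume \<epsilon>: "0 < \<epsilon>"
  obtain l where l: "0 < l" "((\<lambda>t. f t / t) \<longlongrightarrow> l) at_top"
    using assms(9) by blast
  let ?K = "\<lambda>n. card {k \<in> {1..n}. fuzzy_dist (X k) X\<^sub>0 \<ge> \<epsilon>}"
  let ?S = "\<lambda>n. \<Sum>k=1..n. f (fuzzy_dist (X k) X\<^sub>0)"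
  let ?C = "f 1 / f \<epsilon> * (2 / l)"
  have count: "f (real (?K n)) \<le> f 1 / f \<epsilon> * ?S n" for n
    using assms(1,2) \<epsilon>
    by (intro modulus_count_le_sum[OF assms(6)]) (auto intro: fuzzy_dist_nonneg)
  have nonneg: "0 \<le> f x" if "0 \<le> x" for x
    using assms(6) that by (simp add: modulus_function_def)
  have "(\<lambda>n. ?C * (1 / real n powr \<beta> * ?S n)) \<longlonglongrightarrow> ?C * 0"
    using assms(10) unfolding strongly_Cesaro_summable_def by (intro tendsto_mult_left)
  then have lim: "(\<lambda>n. ?C * (1 / real n powr \<beta> * ?S n)) \<longlonglongrightarrow> 0" by simp
  show "(\<lambda>n. 1 / f (real n powr \<gamma>) * f (real (?K n))) \<longlonglongrightarrow> 0"
  proof (rule tendsto_sandwich[OF _ _ tendsto_const lim])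
    show "\<forall>\<^sub>F n in sequentially. 0 \<le> 1 / f (real n powr \<gamma>) * f (real (?K n))"
      using nonneg by (intro always_eventually) simp
    show "\<forall>\<^sub>F n in sequentially. 1 / f (real n powr \<gamma>) * f (real (?K n))
        \<le> ?C * (1 / real n powr \<beta> * ?S n)"
      using eventually_modulus_powr_ge[OF l(2,1) assms(3,4)] eventually_gt_at_top[of 0]
    proof eventually_elim
      case (elim n)
      have pos: "0 < l / 2 * real n powr \<beta>"
        using l elim by simp
      have "f (real (?K n)) / f (real n powr \<gamma>) \<le> (f 1 / f \<epsilon> * ?S n) / (l / 2 * real n powr \<beta>)"
        using count[of n] nonneg[of "real (?K n)"] pos elim by (intro frac_le) auto
      also have "\<dots> = ?C * (1 / real n powr \<beta> * ?S n)"
        by (simp add: mult_ac)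
      finally show ?case by simp
    qed
  qed
qed

end
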